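(* Let $P=ax^3+3bx^2y+3cxy^2+dy^3$ be a binary cubic over $k$ such that $Q_n(P)$ is a square in $k^*$. Suppose $P$ is reducible over $k$, let $q\in k^*$ be a square root of $Q_n(P)$, and suppose $ad\neq0$. Let $\alpha=ad-bc$, $\beta=2(bd-c^2)$, $\gamma=2(b^2-ac)$. (i) If $\beta=\gamma=0$, take $q=ad$, let $r$ be a cube root of $qa$ in $k$ and let $s=\frac{q}{r}$. Then $rx+sy$ divides $P$. (ii) If $\gamma\ne0$, let $r$ be a cube root of $\frac{(\alpha+q)a+\gamma b}{2}$ in $k$ and let $s=-\frac{\gamma}{2r}$. Then $$x+\left(\frac{r-s+b}{a}\right)y$$ divides $P$. (iii) If $\beta\neq0$, let $r$ be a cube root of $\frac{\beta c-(\alpha-q)d}{2}$ in $k$ and let $s=\frac{\beta}{2r}$. Then $$\left(\frac{s-r+c}{d}\right)x+y$$ divides $P$.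
   Context: $k$ is a field of characteristic different from $2$ and $3$. $x,y$ is the standard coordinate basis of $(k^2)^*$. For $P=ax^3+3bx^2y+3cxy^2+dy^3$, $Q_n(P)=a^2d^2-3b^2c^2-6abcd+4b^3d+4ac^3$. In each case the cube root $r$ exists in $k$ because $P$ is reducible over $k$. *)

theory Defs
  imports "HOL-Computational_Algebra.Computational_Algebra"
begin

text \<open>
  The polynomial ring $k[x,y]$ is represented by the type of polynomials in $y$ whose coefficients
  are polynomials in $x$.  Divisibility and irreducibility of forms are the library notions in this
  ring.
\<close>

definition const_form :: "'a::comm_ring_1 \<Rightarrow> 'a poly poly" where
  "const_form e = [:[:e:]:]"

definition var_x :: "'a::comm_ring_1 poly poly" where
  "var_x = [:[:0, 1:]:]"

definition var_y :: "'a::comm_ring_1 poly poly" where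
  "var_y = [:0, 1:]"

definition linear_form :: "'a::comm_ring_1 \<Rightarrow> 'a \<Rightarrow> 'a poly poly" where
  "linear_form e f = const_form e * var_x + const_form f * var_y"

definition binary_cubic :: "'a::comm_ring_1 \<Rightarrow> 'a \<Rightarrow> 'a \<Rightarrow> 'a \<Rightarrow> 'a poly poly" where
  "binary_cubic a b c d =
     const_form a * var_x ^ 3 + 3 * const_form b * var_x ^ 2 * var_y
     + 3 * const_form c * var_x * var_y ^ 2 + const_form d * var_y ^ 3"

text \<open>
  The coefficients are those of the normalization with the binomial factors $3$ split off; when $3$
  is invertible they are determined by the cubic, so that the following is a function of the cubic.
\<close>

definition Q_n :: "'a::comm_ring_1 \<Rightarrow> 'a \<Rightarrow> 'a \<Rightarrow> 'a \<Rightarrow> 'a" where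
  "Q_n a b c d =
     a ^ 2 * d ^ 2 - 3 * b ^ 2 * c ^ 2 - 6 * a * b * c * d + 4 * b ^ 3 * d + 4 * a * c ^ 3"

end

theory Submission
  imports Defs
begin

text \<open>
  The proof is Cardano's formula read backwards.  Completing the cube turns $a^2P(u,v)$ into
  $z^3-3pz+t$ (for $v=1$, $z=au+b$) with $p=b^2-ac=\gamma/2$ and $t=a^2d-3abc+2b^3$.  Up to a
  constant, its discriminant is that of $P$: $t^2-4p^3=a^2Q_n(P)=(qa)^2$.  Hence $A=(t+qa)/2$ and
  $B=(t-qa)/2$ lie in $k$ and satisfy $AB=p^3$ and $A+B=t$; the radicand in (ii) is $A$.

  If $r^3=A$ and $s=-p/r$, then $s^3=-B$, and $z=s-r$ is a zero of the depressed cubic; a zero of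
  $P$ gives a linear factor (\<open>linear_form_dvd_binary_cubic\<close>).

  That $A$ is a cube uses reducibility.  A factorization of $P$ in $k[x][y]$ has a factor of degree
  one in $y$ with constant leading coefficient, hence $P$ has a zero with $x=1$
  (\<open>reducible_binary_cubic_zero\<close>) and the depressed cubic has a zero $z\in k$.  Now
  $(qa)^2=t^2-4p^3=(z^2-4p)(z^2-p)^2$ with $qa\neq0$, so $z^2-4p$ is the square of
  $w=qa/(z^2-p)\in k$, and the solution $(-z+w)/2$ of $u^2+zu+p=0$ has cube $A$
  (\<open>cardano_radicand_is_cube\<close>).

  Part (iii) is part (ii) with the two variables exchanged and $q$, $r$, $s$ replaced by $-q$,
  $-r$, $-s$.  In part (i), $\beta=\gamma=0$ forces $b=c=0$, so $ad\,P$ is the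
  sum of the cubes of $rx$ and $sy$.
\<close>

section \<open>Zeros and linear factors of binary cubics\<close>

definition cubic_value :: "'a::comm_ring_1 \<Rightarrow> 'a \<Rightarrow> 'a \<Rightarrow> 'a \<Rightarrow> 'a \<Rightarrow> 'a \<Rightarrow> 'a" where
  "cubic_value a b c d u v = a * u ^ 3 + 3 * b * u ^ 2 * v + 3 * c * u * v ^ 2 + d * v ^ 3"

lemma cubic_value_swap: "cubic_value d c b a v u = cubic_value a b c d u v"
  by (simp add: cubic_value_def algebra_simps)

lemma linear_form_pCons: "linear_form e f = [:[:0, e:], [:f:]:]"
  by (simp add: linear_form_def const_form_def var_x_def var_y_def)

lemma binary_cubic_pCons:
  "binary_cubic a b c d = [:[:0, 0, 0, a:], [:0, 0, 3 * b:], [:0, 3 * c:], [:d:]:]"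
  by (simp add: binary_cubic_def const_form_def var_x_def var_y_def
      numeral_poly power3_eq_cube power2_eq_square)

lemma linear_form_times_quadratic:
  "linear_form e f * [:[:0, 0, A:], [:0, B:], [:C:]:]
   = [:[:0, 0, 0, e * A:], [:0, 0, e * B + f * A:], [:0, e * C + f * B:], [:f * C:]:]"
  by (simp add: linear_form_pCons algebra_simps)

text \<open>
  A nonzero form $ex+fy$ vanishes exactly on the line through $(f,-e)$.  The quadratic cofactor is found
  by long division, from the $x^3$ end if $e\neq0$ and from the $y^3$ end otherwise; the zero is
  what makes the last coefficient agree.
\<close>

lemma linear_form_dvd_binary_cubic:
  fixes a b c d e f :: "'a::field"
  assumes "e \<noteq> 0 \<or> f \<noteq> 0" and zero: "cubic_value a b c d f (- e) = 0"
  shows "linear_form e f dvd binary_cubic a b c d"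
proof -
  have "\<exists>A B C. e * A = a \<and> e * B + f * A = 3 * b \<and> e * C + f * B = 3 * c \<and> f * C = d"
  proof (cases "e = 0")
    case False
    define A B C where "A = a / e" and "B = (3 * b - f * A) / e" and "C = (3 * c - f * B) / e"
    have A: "e * A = a" and B: "e * B + f * A = 3 * b" and C: "e * C + f * B = 3 * c"
      using False by (simp_all add: A_def B_def C_def)
    have "e ^ 3 * (f * C - d) = cubic_value a b c d f (- e)"
      unfolding cubic_value_def A[symmetric] B[symmetric] C[symmetric]
      by (simp add: algebra_simps power2_eq_square power3_eq_cube)
    then show ?thesis using zero False A B C by auto
  next
    case True
    with assms show ?thesis
      by (intro exI[of _ "3 * b / f"] exI[of _ "3 * c / f"] exI[of _ "d / f"])
         (simp add: cubic_value_def)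
  qed
  then obtain A B C where
    "e * A = a" "e * B + f * A = 3 * b" "e * C + f * B = 3 * c" "f * C = d"
    by blast
  then have "binary_cubic a b c d = linear_form e f * [:[:0, 0, A:], [:0, B:], [:C:]:]"
    by (simp only: linear_form_times_quadratic binary_cubic_pCons)
  then show ?thesis by (rule dvdI)
qed

text \<open>
  The leading coefficient $d$ in $y$ is a unit, so the leading coefficients of two factors are
  constants in $k$, and nonunit factors have positive degree in $y$; one of the degrees is $1$.
  A factor $g_0(x)+g_1y$ with $g_1\in k^*$ vanishes at $(1,-g_0(1)/g_1)$, whether or not $g_0$ is
  a multiple of $x$.
\<close>

lemma reducible_binary_cubic_zero:
  fixes a b c d :: "'a::field"
  assumes "d \<noteq> 0" and red: "\<not> irreducible (binary_cubic a b c d)"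
  shows "\<exists>v. cubic_value a b c d 1 v = 0"
proof -
  let ?P = "binary_cubic a b c d"
  have P0: "?P \<noteq> 0" and deg: "degree ?P = 3" and lead: "lead_coeff ?P = [:d:]"
    using \<open>d \<noteq> 0\<close> by (simp_all add: binary_cubic_pCons)
  have "\<not> ?P dvd 1"
    using deg by (auto simp: is_unit_poly_iff)
  with red P0 obtain f g where fg: "?P = f * g" "\<not> f dvd 1" "\<not> g dvd 1"
    unfolding irreducible_def by blast
  then have fg0: "f \<noteq> 0" "g \<noteq> 0" using P0 by auto
  have degs: "degree f + degree g = 3"
    using deg fg0 by (simp add: fg(1) degree_mult_eq)
  have "lead_coeff f * lead_coeff g = [:d:]"
    using lead by (simp add: fg(1) lead_coeff_mult)
  moreover have "is_unit [:d:]"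
    using \<open>d \<noteq> 0\<close> by (simp add: is_unit_pCons_iff)
  ultimately have units: "is_unit (lead_coeff f)" "is_unit (lead_coeff g)"
    by (metis dvd_trans dvd_triv_left, metis dvd_trans dvd_triv_right)
  have pos: "degree h \<noteq> 0" if "is_unit (lead_coeff h)" "\<not> h dvd 1" for h :: "'a poly poly"
  proof
    assume "degree h = 0"
    then obtain l where "h = [:l:]" by (rule degree_eq_zeroE)
    with that show False by (simp add: is_unit_const_poly_iff)
  qed
  have "degree f = 1 \<or> degree g = 1"
    using degs pos[OF units(1) fg(2)] pos[OF units(2) fg(3)] by linarith
  then obtain h where h: "h dvd ?P" "degree h = 1" "is_unit (lead_coeff h)"
    using fg(1) units by (metis dvd_triv_left dvd_triv_right)
  obtain h1 h0 where h01: "h = [:h0, h1:]" "h1 \<noteq> 0"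
    by (rule degree1_coeffs[OF h(2)])
  obtain e where e: "h1 = [:e:]" "e \<noteq> 0"
    using h(3) h01 by (auto simp: is_unit_poly_iff)
  define v where "v = - poly h0 1 / e"
  have value_P: "poly (poly ?P [:v:]) 1 = cubic_value a b c d 1 v"
    by (simp add: binary_cubic_pCons cubic_value_def algebra_simps power2_eq_square power3_eq_cube)
  have "poly (poly h [:v:]) 1 = 0"
    using e by (simp add: h01 v_def)
  with h(1) have "poly (poly ?P [:v:]) 1 = 0"
    by (auto elim!: dvdE)
  with value_P show ?thesis by auto
qed

section \<open>Cardano's formula\<close>

lemma complete_the_cube:
  fixes a b c d u v :: "'a::idom"
  shows "a ^ 2 * cubic_value a b c d u v
    = (a * u + b * v) ^ 3 - 3 * (b ^ 2 - a * c) * (a * u + b * v) * v ^ 2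
      + (a ^ 2 * d - 3 * a * b * c + 2 * b ^ 3) * v ^ 3"
  unfolding cubic_value_def by algebra

lemma depressed_discriminant:
  fixes a b c d :: "'a::idom"
  shows "(a ^ 2 * d - 3 * a * b * c + 2 * b ^ 3) ^ 2 - 4 * (b ^ 2 - a * c) ^ 3
    = a ^ 2 * Q_n a b c d"
  unfolding Q_n_def by algebra

text \<open>
  If $p\neq0$, the product of the two Cardano radicands $(t\pm D)/2$ is $p^3\neq0$.  So the cube
  root $r$ of the first is nonzero, and $-p/r$ is a cube root of the negative of the second.
\<close>

lemma cardano_zero:
  fixes p t D r s :: "'a::field"
  assumes two: "(2::'a) \<noteq> 0" and "p \<noteq> 0" and D: "D ^ 2 = t ^ 2 - 4 * p ^ 3"
    and r: "r ^ 3 = (t + D) / 2" and s: "s = - (p / r)"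
  shows "r \<noteq> 0" and "(s - r) ^ 3 - 3 * p * (s - r) + t = 0"
proof -
  have r2: "2 * r ^ 3 = t + D" using r two by (simp add: mult.commute)
  have four: "(4::'a) \<noteq> 0"
    using two by (metis mult_eq_0_iff mult_2 numeral_Bit0)
  show r0: "r \<noteq> 0"
  proof
    assume "r = 0"
    then have "D = - t" using r2 by (simp add: eq_neg_iff_add_eq_0 add.commute)
    then have "4 * p ^ 3 = 0" using D by simp
    with four \<open>p \<noteq> 0\<close> show False by simp
  qed
  have rs: "r * s = - p" using r0 s by simp
  have "4 * (r ^ 3 * s ^ 3) = - (4 * p ^ 3)"
    using rs by (simp flip: power_mult_distrib)
  also have "\<dots> = (D + t) * (D - t)" using D by algebra
  also have "\<dots> = 2 * r ^ 3 * (D - t)" using r2 by (simp add: add.commute)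
  finally have "2 * r ^ 3 * (2 * s ^ 3 - (D - t)) = 0" by algebra
  then have s2: "2 * s ^ 3 = D - t" using two r0 by simp
  have "2 * ((s - r) ^ 3 - 3 * p * (s - r) + t) = 0" using rs r2 s2 by algebra
  then show "(s - r) ^ 3 - 3 * p * (s - r) + t = 0" using two mult_eq_0_iff by blast
qed

text \<open>
  If $p\neq0$, a zero $z$ is, over an algebraic closure, $-(u+p/u)$ with $u$ a cube root of the
  radicand, so $u$ solves $u^2+zu+p=0$, and it suffices to solve this quadratic in the field itself.  Its
  discriminant $z^2-4p$ is a square because, at a zero, the discriminant
  $t^2-4p^3$ factors as $(z^2-4p)(z^2-p)^2$.
\<close>

lemma cardano_radicand_is_cube:
  fixes p t D z :: "'a::field"
  assumes two: "(2::'a) \<noteq> 0" and "D \<noteq> 0" and D: "D ^ 2 = t ^ 2 - 4 * p ^ 3"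
    and z: "z ^ 3 - 3 * p * z + t = 0"
  shows "\<exists>r. r ^ 3 = (t + D) / 2"
proof -
  have disc: "D ^ 2 = (z ^ 2 - 4 * p) * (z ^ 2 - p) ^ 2" using D z by algebra
  then have nz: "z ^ 2 - p \<noteq> 0" using \<open>D \<noteq> 0\<close> by auto
  define w where "w = D / (z ^ 2 - p)"
  have wD: "w * (z ^ 2 - p) = D" using nz by (simp add: w_def)
  have w: "w ^ 2 = z ^ 2 - 4 * p" using nz by (simp add: w_def power_divide disc)
  define r where "r = (w - z) / 2"
  have "2 * r = w - z" using two by (simp add: r_def)
  then have "4 * (2 * r ^ 3) = 4 * (t + D)" using w wD z by algebra
  moreover have "(4::'a) \<noteq> 0"
    using two by (metis mult_eq_0_iff numeral_Bit0 mult_2)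
  ultimately have "2 * r ^ 3 = t + D" using mult_left_cancel by blast
  then have "r ^ 3 = (t + D) / 2" using two by (simp add: eq_divide_eq mult.commute)
  then show ?thesis by blast
qed

section \<open>Cardano's formula for binary cubics\<close>

text \<open>
  The two preceding results with $p=\gamma/2$ and $D=qa$; the radicand $(t+D)/2$ is the expression
  in $\alpha$, $\gamma$ and $q$ that occurs here because $t=\alpha a+\gamma b$.
\<close>

lemma binary_cubic_cardano:
  fixes a b c d q \<alpha> \<gamma> :: "'a::field"
  assumes two: "(2::'a) \<noteq> 0" and "a \<noteq> 0" and q: "q \<noteq> 0" "q ^ 2 = Q_n a b c d"
    and \<alpha>: "\<alpha> = a * d - b * c" and \<gamma>: "\<gamma> = 2 * (b ^ 2 - a * c)"
  shows cardano_cube_root_exists: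
      "v \<noteq> 0 \<Longrightarrow> cubic_value a b c d u v = 0 \<Longrightarrow>
        \<exists>r. r ^ 3 = ((\<alpha> + q) * a + \<gamma> * b) / 2"
    and cardano_cube_root_nonzero:
      "\<gamma> \<noteq> 0 \<Longrightarrow> r ^ 3 = ((\<alpha> + q) * a + \<gamma> * b) / 2 \<Longrightarrow> r \<noteq> 0"
    and cardano_cube_root_zero:
      "\<gamma> \<noteq> 0 \<Longrightarrow> r ^ 3 = ((\<alpha> + q) * a + \<gamma> * b) / 2 \<Longrightarrow> s = - (\<gamma> / (2 * r)) \<Longrightarrow>
        cubic_value a b c d ((r - s + b) / a) (- 1) = 0"
proof -
  define p t D where "p = b ^ 2 - a * c" and "t = a ^ 2 * d - 3 * a * b * c + 2 * b ^ 3"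
    and "D = q * a"
  have D: "D ^ 2 = t ^ 2 - 4 * p ^ 3"
    using depressed_discriminant[of a d b c] q(2)
    by (simp add: D_def p_def t_def power_mult_distrib mult.commute)
  have D0: "D \<noteq> 0" using \<open>a \<noteq> 0\<close> q(1) by (simp add: D_def)
  have radicand: "(\<alpha> + q) * a + \<gamma> * b = t + D"
    unfolding \<alpha> \<gamma> t_def D_def by algebra
  have \<gamma>p: "\<gamma> = 2 * p" by (simp add: \<gamma> p_def)
  {
    assume "v \<noteq> 0" and zero: "cubic_value a b c d u v = 0"
    define z where "z = (a * u + b * v) / v"
    have zv: "a * u + b * v = z * v" using \<open>v \<noteq> 0\<close> by (simp add: z_def)
    have "v ^ 3 * (z ^ 3 - 3 * p * z + t) = a ^ 2 * cubic_value a b c d u v"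
      unfolding complete_the_cube zv p_def t_def by algebra
    then have "z ^ 3 - 3 * p * z + t = 0" using zero \<open>v \<noteq> 0\<close> by simp
    from cardano_radicand_is_cube[OF two D0 D this]
    show "\<exists>r. r ^ 3 = ((\<alpha> + q) * a + \<gamma> * b) / 2" by (simp only: radicand)
  }
  {
    assume "\<gamma> \<noteq> 0" and r: "r ^ 3 = ((\<alpha> + q) * a + \<gamma> * b) / 2"
    then have p0: "p \<noteq> 0" and r': "r ^ 3 = (t + D) / 2"
      by (auto simp: \<gamma>p simp flip: radicand)
    show "r \<noteq> 0" by (rule cardano_zero(1)[OF two p0 D r' refl])
    assume "s = - (\<gamma> / (2 * r))"
    then have s': "s = - (p / r)" using two by (simp add: \<gamma>p)
    define m where "m = (r - s + b) / a"
    have m: "a * m = r - s + b" using \<open>a \<noteq> 0\<close> by (simp add: m_def)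
    have "(s - r) ^ 3 - 3 * p * (s - r) + t = 0"
      by (rule cardano_zero(2)[OF two p0 D r' s'])
    moreover have "a ^ 2 * cubic_value a b c d m (- 1) = - ((s - r) ^ 3 - 3 * p * (s - r) + t)"
      unfolding complete_the_cube m p_def t_def by algebra
    ultimately have "a ^ 2 * cubic_value a b c d m (- 1) = 0" by simp
    then show "cubic_value a b c d ((r - s + b) / a) (- 1) = 0"
      using \<open>a \<noteq> 0\<close> by (simp add: m_def)
  }
qed

section \<open>Vanishing Hessian coefficients\<close>

text \<open>
  If $c\neq0$, the two equations give $ad=bc$, and then all of $Q_n$ cancels.
\<close>

lemma degenerate_hessian_imp_pure:
  fixes a b c d :: "'a::field"
  assumes "Q_n a b c d \<noteq> 0" and bd: "b * d = c ^ 2" and ac: "b ^ 2 = a * c"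
  shows "b = 0" and "c = 0"
proof -
  have "c * (a * d - b * c) = 0" using bd ac by algebra
  moreover have "a * d - b * c \<noteq> 0"
  proof
    assume "a * d - b * c = 0"
    then have "Q_n a b c d = 0" unfolding Q_n_def using bd ac by algebra
    with assms(1) show False by simp
  qed
  ultimately show "c = 0" by simp
  with ac show "b = 0" by simp
qed

section \<open>Linear factors from cube roots\<close>

theorem proposition3p40:
  fixes a b c d q \<alpha> \<beta> \<gamma> :: "'a::field"
    and P :: "'a poly poly"
  assumes char: "CHAR('a) \<noteq> 2" "CHAR('a) \<noteq> 3"
    and P: "P = binary_cubic a b c d"
    and q: "q \<noteq> 0" "q ^ 2 = Q_n a b c d"
    and reducible: "\<not> irreducible P"
    and ad: "a * d \<noteq> 0"
    and \<alpha>: "\<alpha> = a * d - b * c"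
    and \<beta>: "\<beta> = 2 * (b * d - c ^ 2)"
    and \<gamma>: "\<gamma> = 2 * (b ^ 2 - a * c)"
  shows
    "(\<beta> = 0 \<and> \<gamma> = 0 \<longrightarrow>
        (a * d) ^ 2 = Q_n a b c d \<and>
        (\<exists>r. r ^ 3 = (a * d) * a) \<and>
        (\<forall>r s. r ^ 3 = (a * d) * a \<and> s = (a * d) / r \<longrightarrow>
           r \<noteq> 0 \<and> linear_form r s dvd P)) \<and>
     (\<gamma> \<noteq> 0 \<longrightarrow>
        (\<exists>r. r ^ 3 = ((\<alpha> + q) * a + \<gamma> * b) / 2) \<and>
        (\<forall>r s. r ^ 3 = ((\<alpha> + q) * a + \<gamma> * b) / 2 \<and> s = - (\<gamma> / (2 * r)) \<longrightarrow>
           r \<noteq> 0 \<and> linear_form 1 ((r - s + b) / a) dvd P)) \<and>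
     (\<beta> \<noteq> 0 \<longrightarrow>
        (\<exists>r. r ^ 3 = (\<beta> * c - (\<alpha> - q) * d) / 2) \<and>
        (\<forall>r s. r ^ 3 = (\<beta> * c - (\<alpha> - q) * d) / 2 \<and> s = \<beta> / (2 * r) \<longrightarrow>
           r \<noteq> 0 \<and> linear_form ((s - r + c) / d) 1 dvd P))"
proof (intro conjI impI allI; (elim conjE)?)
  have a0: "a \<noteq> 0" and d0: "d \<noteq> 0" using ad by auto
  have two: "(2::'a) \<noteq> 0"
  proof
    assume "(2::'a) = 0"
    then have "of_nat 2 = (0::'a)" by simp
    then have "CHAR('a) dvd 2" by (simp only: of_nat_eq_0_iff_char_dvd)
    then have "CHAR('a) \<le> 2" by (rule dvd_imp_le) simp
    moreover have "CHAR('a) \<noteq> 0" using \<open>CHAR('a) dvd 2\<close> by (intro notI) simp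
    ultimately show False using char(1) CHAR_not_1[where 'a = 'a] by linarith
  qed
  obtain v where v: "cubic_value a b c d 1 v = 0"
    using reducible_binary_cubic_zero[OF d0] reducible P by blast
  have v0: "v \<noteq> 0" using v a0 by (auto simp: cubic_value_def)
  {
    assume "\<beta> = 0" and "\<gamma> = 0"
    then have "b * d = c ^ 2" and "b ^ 2 = a * c" using two by (simp_all add: \<beta> \<gamma>)
    then have b0: "b = 0" and c0: "c = 0"
      using degenerate_hessian_imp_pure[of a b c d] q by (metis power_not_zero)+
    show "(a * d) ^ 2 = Q_n a b c d"
      by (simp add: Q_n_def b0 c0 power_mult_distrib)
    have v3: "a + d * v ^ 3 = 0" using v by (simp add: cubic_value_def b0 c0)
    have "(- a / v) ^ 3 = a * d * a"
    proof -
      have "v ^ 3 * (a * d * a) = - (a ^ 3)" using v3 by algebra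
      then show ?thesis using v0 by (simp add: power_divide field_simps)
    qed
    then show "\<exists>r. r ^ 3 = a * d * a" by blast
    fix r s
    assume r: "r ^ 3 = a * d * a" and s: "s = a * d / r"
    show r0: "r \<noteq> 0" using r a0 d0 by auto
    have "r * s = a * d" using s r0 by simp
    then have "r ^ 3 * s ^ 3 = (a * d) ^ 3" by (metis power_mult_distrib)
    then have "(a * d * a) * (s ^ 3 - a * d ^ 2) = 0" using r by algebra
    then have "s ^ 3 = a * d ^ 2" using a0 d0 by simp
    then have "cubic_value a b c d s (- r) = 0"
      using r unfolding cubic_value_def b0 c0 by algebra
    then show "linear_form r s dvd P"
      unfolding P using r0 by (intro linear_form_dvd_binary_cubic) auto
  }
  {
    assume "\<gamma> \<noteq> 0"
    note cardano = two a0 q \<alpha> \<gamma>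
    show "\<exists>r. r ^ 3 = ((\<alpha> + q) * a + \<gamma> * b) / 2"
      by (rule cardano_cube_root_exists[OF cardano v0 v])
    fix r s
    assume r: "r ^ 3 = ((\<alpha> + q) * a + \<gamma> * b) / 2" and s: "s = - (\<gamma> / (2 * r))"
    show "r \<noteq> 0" by (rule cardano_cube_root_nonzero[OF cardano \<open>\<gamma> \<noteq> 0\<close> r])
    show "linear_form 1 ((r - s + b) / a) dvd P"
      unfolding P using cardano_cube_root_zero[OF cardano \<open>\<gamma> \<noteq> 0\<close> r s]
      by (intro linear_form_dvd_binary_cubic) auto
  }
  {
    assume "\<beta> \<noteq> 0"
    \<comment> \<open>Exchanging the variables sends $(\alpha,\gamma,q)$ to $(\alpha,-\beta,-q)$ and the radicand
      to its negative.\<close>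
    have q': "- q \<noteq> 0" "(- q) ^ 2 = Q_n d c b a"
      using q by (simp_all add: Q_n_def algebra_simps)
    have \<alpha>': "\<alpha> = d * a - c * b" by (simp add: \<alpha> mult.commute)
    have \<beta>': "- \<beta> = 2 * (c ^ 2 - d * b)" by (simp add: \<beta> algebra_simps)
    have \<beta>0: "- \<beta> \<noteq> 0" using \<open>\<beta> \<noteq> 0\<close> by simp
    note cardano = two d0 q' \<alpha>' \<beta>'
    have radicand: "((\<alpha> + - q) * d + - \<beta> * c) / 2 = - ((\<beta> * c - (\<alpha> - q) * d) / 2)"
      by (simp flip: minus_divide_left add: diff_divide_distrib algebra_simps)
    have "cubic_value d c b a v 1 = 0" using v by (simp add: cubic_value_swap)
    from cardano_cube_root_exists[OF cardano _ this]
    obtain r' where "r' ^ 3 = - ((\<beta> * c - (\<alpha> - q) * d) / 2)"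
      unfolding radicand by auto
    then have "(- r') ^ 3 = (\<beta> * c - (\<alpha> - q) * d) / 2" by simp
    then show "\<exists>r. r ^ 3 = (\<beta> * c - (\<alpha> - q) * d) / 2" by blast
    fix r s
    assume r: "r ^ 3 = (\<beta> * c - (\<alpha> - q) * d) / 2" and s: "s = \<beta> / (2 * r)"
    have r': "(- r) ^ 3 = ((\<alpha> + - q) * d + - \<beta> * c) / 2" unfolding radicand by (simp add: r)
    have s': "- s = - (- \<beta> / (2 * (- r)))" by (simp add: s)
    show "r \<noteq> 0" using cardano_cube_root_nonzero[OF cardano \<beta>0 r'] by simp
    have "cubic_value d c b a ((s - r + c) / d) (- 1) = 0"
      using cardano_cube_root_zero[OF cardano \<beta>0 r' s'] by (simp add: add.commute)
    then have "cubic_value a b c d (- 1) ((s - r + c) / d) = 0"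
      by (simp only: cubic_value_swap)
    then have "- cubic_value a b c d 1 (- ((s - r + c) / d)) = 0"
      by (simp add: cubic_value_def algebra_simps)
    then show "linear_form ((s - r + c) / d) 1 dvd P"
      unfolding P by (intro linear_form_dvd_binary_cubic) auto
  }
qed

end
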